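(* Let $n\ge1$ and let $X\subseteq\mathbb{R}^n$ be compact, regarded as a compact metric space $(X,d)$. Let $\Psi\subseteq C_b(X)$ be the set of antisymmetric exponentials on $X$. Then $\Psi$ is dense in $C_b(X)$ with respect to the supremum norm: for every $f\in C_b(X)$ and every $\varepsilon>0$ there exists $\psi\in\Psi$ with $\sup_{x\in X}|f(x)-\psi(x)|<\varepsilon$.
   Context: $d$ denotes the metric inherited from $\mathbb{R}^n$. $C_b(X)$ is the space of continuous bounded functions $X\to\mathbb{R}$ with the supremum norm. A function $\psi:X\to\mathbb{R}$ is an antisymmetric exponential if there exist a natural number $M\ge1$ and continuous functions $g_{k,j},h_{k,j}\in C(\mathbb{R})$ ($1\le k\le M$, $1\le j\le n$) such that for all $x=(x_1,\dots,x_n)\in X$ $$\psi(x)=\sum_{k=1}^{M}\Big(\exp\big(\textstyle\sum_{j=1}^n g_{k,j}(x_j)\big)-\exp\big(\sum_{j=1}^n h_{k,j}(x_j)\big)\Big).$$ $\Psi$ is the set of all antisymmetric exponentials on $X$. *)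

theory Defs
  imports "HOL-Analysis.Analysis"
begin

text \<open>
  A function \<open>X \<rightarrow> \<real>\<close> on a subset \<open>X\<close> of \<open>\<real>\<^sup>n\<close> is represented by an element of
  \<^term>\<open>extensional X\<close>, as in \<^const>\<open>cfunspace\<close>, so that functions are identified exactly
  when they agree on \<open>X\<close>.
\<close>

abbreviation Cb :: "(real ^ 'n) set \<Rightarrow> (real ^ 'n \<Rightarrow> real) metric" where
  "Cb X \<equiv> cfunspace (top_of_set X) euclidean_metric"

definition antisymmetric_exponential ::
    "(real ^ 'n) set \<Rightarrow> (real ^ 'n \<Rightarrow> real) \<Rightarrow> bool" where
  "antisymmetric_exponential X \<psi> \<longleftrightarrow>
     (\<exists>M\<ge>(1::nat). \<exists>g h :: nat \<Rightarrow> 'n \<Rightarrow> real \<Rightarrow> real.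
        (\<forall>k\<in>{1..M}. \<forall>j. continuous_on UNIV (g k j) \<and> continuous_on UNIV (h k j)) \<and>
        (\<forall>x\<in>X. \<psi> x = (\<Sum>k=1..M. (exp (\<Sum>j\<in>UNIV. g k j (x $ j))
                                    - exp (\<Sum>j\<in>UNIV. h k j (x $ j))))))"

definition antisymmetric_exponentials ::
    "(real ^ 'n) set \<Rightarrow> (real ^ 'n \<Rightarrow> real) set" where
  "antisymmetric_exponentials X = {\<psi> \<in> extensional X. antisymmetric_exponential X \<psi>}"

lemma mem_Cb_iff:
  "f \<in> mspace (Cb X) \<longleftrightarrow> f \<in> extensional X \<and> continuous_on X f \<and> bounded (f ` X)"
  by auto

text \<open>For empty \<open>X\<close> the distance is 0, whereas \<open>SUP\<close> over the empty set is unspecified on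
  \<^typ>\<open>real\<close>.\<close>

lemma mdist_Cb:
  assumes "f \<in> mspace (Cb X)" "g \<in> mspace (Cb X)"
  shows "mdist (Cb X) f g = (if X = {} then 0 else (SUP x\<in>X. \<bar>f x - g x\<bar>))"
  using assms
  by (auto simp: mdist_cfunspace_eq_mdist_funspace Met_TC.fdist_def Met_TC.fspace_def
      dist_real_def)

end

theory Submission
  imports Defs
begin

text \<open>
  The theorem is an instance of the Stone--Weierstrass theorem. The antisymmetric exponentials are
  the finite sums of differences \<open>e\<^sup>u - e\<^sup>v\<close> with additively separable exponents \<open>u\<close>, \<open>v\<close>, and they
  are closed under multiplication because
  \<open>(e\<^sup>u - e\<^sup>v) (e\<^sup>s - e\<^sup>t) = (e\<^bsup>u+s\<^esup> - e\<^bsup>u+t\<^esup>) + (e\<^bsup>v+t\<^esup> - e\<^bsup>v+s\<^esup>)\<close>.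
\<close>

text \<open>Exponents are taken on all of \<open>real ^ 'n\<close>, so the closure properties below
  are identities between total functions; \<open>X\<close> enters only when they are turned into
  \<open>antisymmetric_exponential X\<close>.\<close>

definition additively_separable :: "(real ^ 'n \<Rightarrow> real) \<Rightarrow> bool" where
  "additively_separable u \<longleftrightarrow>
     (\<exists>g. (\<forall>j. continuous_on UNIV (g j)) \<and> u = (\<lambda>x. \<Sum>j\<in>UNIV. g j (x $ j)))"

lemma additively_separable_add:
  assumes "additively_separable u" "additively_separable v"
  shows "additively_separable (\<lambda>x. u x + v x)"
proof -
  obtain g h where "\<forall>j. continuous_on UNIV (g j)" "u = (\<lambda>x. \<Sum>j\<in>UNIV. g j (x $ j))"
    "\<forall>j. continuous_on UNIV (h j)" "v = (\<lambda>x. \<Sum>j\<in>UNIV. h j (x $ j))"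
    using assms unfolding additively_separable_def by blast
  then show ?thesis
    unfolding additively_separable_def
    by (intro exI[of _ "\<lambda>j t. g j t + h j t"]) (auto simp: sum.distrib intro: continuous_intros)
qed

lemma additively_separable_const: "additively_separable (\<lambda>x :: real ^ 'n. c)"
  unfolding additively_separable_def
  \<comment> \<open>The constant is shared equally among the coordinates, so that the sum over the
    nonempty index type returns \<open>c\<close>.\<close>
  by (intro exI[of _ "\<lambda>j t. c / real CARD('n)"]) auto

lemma additively_separable_component: "additively_separable (\<lambda>x. x $ i)"
proof -
  have "continuous_on UNIV (\<lambda>t :: real. if j = i then t else 0)" for j
    by (cases "j = i") auto
  then show ?thesis
    unfolding additively_separable_def
    by (intro exI[of _ "\<lambda>j t. if j = i then t else 0"]) auto
qed

text \<open>An index-free form of the antisymmetric exponentials: products are then handled by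
  induction on the summands instead of by reindexing double sums.\<close>

inductive exp_diff_sum :: "(real ^ 'n \<Rightarrow> real) \<Rightarrow> bool" where
  base: "additively_separable u \<Longrightarrow> additively_separable v \<Longrightarrow>
    exp_diff_sum (\<lambda>x. exp (u x) - exp (v x))"
| add: "exp_diff_sum f \<Longrightarrow> exp_diff_sum g \<Longrightarrow> exp_diff_sum (\<lambda>x. f x + g x)"

text \<open>By bilinearity, a product reduces to products of single differences. The induction here
  splits the second factor; \<open>exp_diff_sum_mult\<close> then splits the first.\<close>

lemma exp_diff_sum_mult_base:
  assumes "exp_diff_sum g" "additively_separable u" "additively_separable v"
  shows "exp_diff_sum (\<lambda>x. (exp (u x) - exp (v x)) * g x)"
  using assms
proof (induction rule: exp_diff_sum.induct)
  case (base s t)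
  have "exp_diff_sum (\<lambda>x. (exp (u x + s x) - exp (u x + t x)) + (exp (v x + t x) - exp (v x + s x)))"
    by (intro exp_diff_sum.intros additively_separable_add base)
  then show ?case
    by (simp add: exp_add algebra_simps)
next
  case (add f g)
  then show ?case
    by (simp add: distrib_left exp_diff_sum.add)
qed

lemma exp_diff_sum_mult:
  assumes "exp_diff_sum f" "exp_diff_sum g"
  shows "exp_diff_sum (\<lambda>x. f x * g x)"
  using assms
proof (induction rule: exp_diff_sum.induct)
  case (base u v)
  then show ?case
    by (simp add: exp_diff_sum_mult_base)
next
  case (add f g)
  then show ?case
    by (simp add: distrib_right exp_diff_sum.add)
qed

lemma exp_diff_sum_const: "exp_diff_sum (\<lambda>x. c)"
proof -
  \<comment> \<open>Any real \<open>c\<close> is a difference of two positive numbers, and a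
    positive number is the exponential of a constant exponent.\<close>
  have "exp_diff_sum (\<lambda>x :: real ^ 'n. exp (ln (1 + \<bar>c\<bar>)) - exp (ln (1 + \<bar>c\<bar> - c)))"
    by (intro exp_diff_sum.base additively_separable_const)
  moreover have "1 + \<bar>c\<bar> > 0" "1 + \<bar>c\<bar> - c > 0"
    by linarith+
  ultimately show ?thesis
    by simp
qed

lemma exp_diff_sum_separates_points:
  assumes "x \<noteq> y"
  shows "\<exists>f. exp_diff_sum f \<and> f x \<noteq> f y"
proof -
  obtain i where "x $ i \<noteq> y $ i"
    using assms by (auto simp: vec_eq_iff)
  \<comment> \<open>Injectivity of \<open>exp\<close> separates the points; the constant
    \<open>exp 0\<close> cancels in the comparison and only brings the function into the form of a
    difference.\<close>
  moreover have "exp_diff_sum (\<lambda>x. exp (x $ i) - exp 0)"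
    by (intro exp_diff_sum.base additively_separable_component additively_separable_const)
  ultimately show ?thesis
    by (intro exI[of _ "\<lambda>x. exp (x $ i) - exp 0"]) auto
qed

text \<open>Concatenates two families indexed from 1: the shift by \<open>M\<close> sends index
  \<open>M + 1\<close> to 1. This is how two representations of lengths \<open>M\<close> and
  \<open>N\<close> merge into one of length \<open>M + N\<close>.\<close>

lemma sum_append_index:
  fixes a b :: "nat \<Rightarrow> 'a::comm_monoid_add"
  shows "(\<Sum>k=1..M+N. if k \<le> M then a k else b (k - M)) = (\<Sum>k=1..M. a k) + (\<Sum>k=1..N. b k)"
proof -
  have "(\<Sum>k=M+1..M+N. if k \<le> M then a k else b (k - M)) = (\<Sum>k=1..N. b k)"
    by (rule sum.reindex_bij_witness[of _ "\<lambda>k. k + M" "\<lambda>k. k - M"]) auto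
  moreover have "(\<Sum>k=1..M. if k \<le> M then a k else b (k - M)) = (\<Sum>k=1..M. a k)"
    by (rule sum.cong) auto
  ultimately show ?thesis
    using sum.ub_add_nat[of 1 M "\<lambda>k. if k \<le> M then a k else b (k - M)" N] by simp
qed

lemma antisymmetric_exponential_add:
  assumes "antisymmetric_exponential X \<phi>" "antisymmetric_exponential X \<psi>"
  shows "antisymmetric_exponential X (\<lambda>x. \<phi> x + \<psi> x)"
proof -
  obtain M and g h :: "nat \<Rightarrow> 'a \<Rightarrow> real \<Rightarrow> real" where M: "M \<ge> 1"
    "\<And>k j. k \<in> {1..M} \<Longrightarrow> continuous_on UNIV (g k j) \<and> continuous_on UNIV (h k j)"
    "\<And>x. x \<in> X \<Longrightarrow> \<phi> x = (\<Sum>k=1..M. exp (\<Sum>j\<in>UNIV. g k j (x $ j)) - exp (\<Sum>j\<in>UNIV. h k j (x $ j)))"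
    using assms(1) unfolding antisymmetric_exponential_def by blast
  obtain N and g' h' :: "nat \<Rightarrow> 'a \<Rightarrow> real \<Rightarrow> real" where N: "N \<ge> 1"
    "\<And>k j. k \<in> {1..N} \<Longrightarrow> continuous_on UNIV (g' k j) \<and> continuous_on UNIV (h' k j)"
    "\<And>x. x \<in> X \<Longrightarrow> \<psi> x = (\<Sum>k=1..N. exp (\<Sum>j\<in>UNIV. g' k j (x $ j)) - exp (\<Sum>j\<in>UNIV. h' k j (x $ j)))"
    using assms(2) unfolding antisymmetric_exponential_def by blast
  define G where "G k = (if k \<le> M then g k else g' (k - M))" for k
  define H where "H k = (if k \<le> M then h k else h' (k - M))" for k
  have "continuous_on UNIV (G k j) \<and> continuous_on UNIV (H k j)" if "k \<in> {1..M+N}" for k j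
  proof (cases "k \<le> M")
    case True
    then show ?thesis
      using that M(2) by (simp add: G_def H_def)
  next
    case False
    then have "k - M \<in> {1..N}"
      using that by auto
    then show ?thesis
      using False N(2) by (simp add: G_def H_def)
  qed
  moreover have "\<phi> x + \<psi> x =
      (\<Sum>k=1..M+N. exp (\<Sum>j\<in>UNIV. G k j (x $ j)) - exp (\<Sum>j\<in>UNIV. H k j (x $ j)))"
    if "x \<in> X" for x
    \<comment> \<open>Read from right to left, \<open>sum_append_index\<close> fuses the two sums;
      what remains is to move the case distinction on \<open>k \<le> M\<close> inside the
      exponents.\<close>
    unfolding M(3)[OF that] N(3)[OF that] sum_append_index[symmetric]
    by (rule sum.cong) (auto simp: G_def H_def)
  ultimately show ?thesis
    unfolding antisymmetric_exponential_def
    using M(1) by (intro exI[of _ "M + N"] exI[of _ G] exI[of _ H] conjI) auto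
qed

lemma exp_diff_sum_imp_antisymmetric_exponential:
  assumes "exp_diff_sum f"
  shows "antisymmetric_exponential X f"
  using assms
proof (induction rule: exp_diff_sum.induct)
  case (base u v)
  then obtain g h where "\<forall>j. continuous_on UNIV (g j)" "u = (\<lambda>x. \<Sum>j\<in>UNIV. g j (x $ j))"
    "\<forall>j. continuous_on UNIV (h j)" "v = (\<lambda>x. \<Sum>j\<in>UNIV. h j (x $ j))"
    unfolding additively_separable_def by blast
  then show ?case
    unfolding antisymmetric_exponential_def
    by (intro exI[of _ 1] exI[of _ "\<lambda>k. g"] exI[of _ "\<lambda>k. h"] conjI) auto
next
  case (add f g)
  then show ?case
    by (intro antisymmetric_exponential_add)
qed

lemma continuous_on_antisymmetric_exponential:
  assumes "antisymmetric_exponential X \<psi>"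
  shows "continuous_on X \<psi>"
proof -
  obtain M and g h :: "nat \<Rightarrow> 'a \<Rightarrow> real \<Rightarrow> real" where
    cont: "\<And>k j. k \<in> {1..M} \<Longrightarrow> continuous_on UNIV (g k j) \<and> continuous_on UNIV (h k j)"
    and eq: "\<And>x. x \<in> X \<Longrightarrow> \<psi> x =
      (\<Sum>k=1..M. exp (\<Sum>j\<in>UNIV. g k j (x $ j)) - exp (\<Sum>j\<in>UNIV. h k j (x $ j)))"
    using assms unfolding antisymmetric_exponential_def by blast
  have "continuous_on X (\<lambda>x. g k j (x $ j))" "continuous_on X (\<lambda>x. h k j (x $ j))"
    if "k \<in> {1..M}" for k j
    using cont[OF that, of j]
    by (auto intro!: continuous_on_compose2[of UNIV _ X "\<lambda>x. x $ j"] continuous_intros)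
  then have "continuous_on X
      (\<lambda>x. \<Sum>k=1..M. exp (\<Sum>j\<in>UNIV. g k j (x $ j)) - exp (\<Sum>j\<in>UNIV. h k j (x $ j)))"
    by (intro continuous_intros)
  then show ?thesis
    \<comment> \<open>The representation fixes \<open>\<psi>\<close> on \<open>X\<close> only, which
      suffices for continuity on \<open>X\<close>.\<close>
    using eq by (simp cong: continuous_on_cong)
qed

lemma antisymmetric_exponentials_subset_Cb:
  assumes "compact X"
  shows "antisymmetric_exponentials X \<subseteq> mspace (Cb X)"
  unfolding mem_Cb_iff subset_iff antisymmetric_exponentials_def
  using assms continuous_on_antisymmetric_exponential
  by (auto intro!: compact_imp_bounded compact_continuous_image)

lemma antisymmetric_exponential_approximation:
  assumes "compact X" "continuous_on X f" "\<epsilon> > 0"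
  shows "\<exists>\<psi>\<in>antisymmetric_exponentials X. \<forall>x\<in>X. \<bar>f x - \<psi> x\<bar> < \<epsilon>"
proof -
  have "\<exists>g. exp_diff_sum g \<and> (\<forall>x\<in>X. \<bar>f x - g x\<bar> < \<epsilon>)"
    using assms
    \<comment> \<open>The class \<open>exp_diff_sum\<close> contains the constants, is closed under
      sums and products and separates points; continuity of its members on \<open>X\<close> comes
      through their indexed form.\<close>
    by (intro Stone_Weierstrass_HOL)
       (blast intro: exp_diff_sum_const exp_diff_sum.add exp_diff_sum_mult exp_diff_sum_separates_points
         continuous_on_antisymmetric_exponential exp_diff_sum_imp_antisymmetric_exponential)+
  then obtain g where g: "exp_diff_sum g" "\<forall>x\<in>X. \<bar>f x - g x\<bar> < \<epsilon>"
    by blast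
  \<comment> \<open>Restriction makes \<open>g\<close> extensional and keeps its values on
    \<open>X\<close>, the only ones that the representation constrains.\<close>
  have "restrict g X \<in> antisymmetric_exponentials X"
    using exp_diff_sum_imp_antisymmetric_exponential[OF g(1), of X]
    by (simp add: antisymmetric_exponentials_def antisymmetric_exponential_def)
  then show ?thesis
    using g(2) by (intro bexI[of _ "restrict g X"]) auto
qed

lemma antisymmetric_exponential_mdist_approximation:
  assumes "compact X" "f \<in> mspace (Cb X)" "\<epsilon> > 0"
  shows "\<exists>\<psi>\<in>antisymmetric_exponentials X. mdist (Cb X) f \<psi> < \<epsilon>"
proof -
  \<comment> \<open>A strict pointwise bound passes to the supremum only as a weak one; halving
    \<open>\<epsilon>\<close> restores strictness.\<close>
  obtain \<psi> where \<psi>: "\<psi> \<in> antisymmetric_exponentials X" "\<And>x. x \<in> X \<Longrightarrow> \<bar>f x - \<psi> x\<bar> < \<epsilon> / 2"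
    using antisymmetric_exponential_approximation[OF assms(1), of f "\<epsilon> / 2"] assms(2,3)
    unfolding mem_Cb_iff by auto
  have "(SUP x\<in>X. \<bar>f x - \<psi> x\<bar>) \<le> \<epsilon> / 2" if "X \<noteq> {}"
    using that \<psi>(2) by (intro cSUP_least) (auto intro: less_imp_le)
  moreover have "\<psi> \<in> mspace (Cb X)"
    using \<psi>(1) antisymmetric_exponentials_subset_Cb[OF assms(1)] by blast
  ultimately have "mdist (Cb X) f \<psi> < \<epsilon>"
    unfolding mdist_Cb[OF assms(2) \<open>\<psi> \<in> mspace (Cb X)\<close>] using assms(3) by (cases "X = {}") auto
  then show ?thesis
    using \<psi>(1) by blast
qed

theorem theorem46:
  fixes X :: "(real ^ 'n) set"
  assumes "compact X"
  shows "antisymmetric_exponentials X \<subseteq> mspace (Cb X) \<and>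
         mtopology_of (Cb X) closure_of antisymmetric_exponentials X = mspace (Cb X) \<and>
         (\<forall>f \<in> mspace (Cb X). \<forall>\<epsilon>>0. \<exists>\<psi> \<in> antisymmetric_exponentials X.
            mdist (Cb X) f \<psi> < \<epsilon>)"
proof (intro conjI)
  show sub: "antisymmetric_exponentials X \<subseteq> mspace (Cb X)"
    using antisymmetric_exponentials_subset_Cb[OF assms] .
  show approx: "\<forall>f \<in> mspace (Cb X). \<forall>\<epsilon>>0. \<exists>\<psi> \<in> antisymmetric_exponentials X.
      mdist (Cb X) f \<psi> < \<epsilon>"
    using antisymmetric_exponential_mdist_approximation[OF assms] by blast
  interpret C: Metric_space "mspace (Cb X)" "mdist (Cb X)"
    by (rule Metric_space_mspace_mdist)
  show "mtopology_of (Cb X) closure_of antisymmetric_exponentials X = mspace (Cb X)"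
    unfolding mtopology_of_def C.metric_closure_of
    \<comment> \<open>A point lies in the closure iff every ball around it meets the set.
      \<open>approx\<close> gives the small distance, and \<open>sub\<close> the membership in the
      space that \<open>C.in_mball\<close> also demands.\<close>
    using approx sub by (simp only: C.in_mball) blast
qed

end
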